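(* Let $a\ge 1$ and $q\ge 2$ be integers, let $S_{a,q}=\{aq^m : m\in\mathbb Z_{\ge 0}\}\subset\mathbb Z$, and let $n!_{S_{a,q}}$ denote the $n$th Bhargava factorial of $S_{a,q}$. Put $r=q^{-1}$ and let $Q_r$ be the diagonal operator on $\ell^2(\mathbb Z_{\ge 0})$ given on the standard orthonormal basis by $Q_r e_m=r^m e_m$ for $m\ge 0$. Then $Q_r$ is trace class, and the meromorphic function $$\Gamma_{a,q}^{\mathrm{geom}}(z)=a^{z-1}q^{(z-1)^2}\,\frac{\det(I-rQ_r)}{\det(I-r^zQ_r)}\qquad(z\in\mathbb C)$$ (with Fredholm determinants) satisfies $$\Gamma_{a,q}^{\mathrm{geom}}(1)=1,\qquad \Gamma_{a,q}^{\mathrm{geom}}(n+1)=n!_{S_{a,q}}\quad\text{for all integers } n\ge 0.$$ Equivalently, as meromorphic functions of $z$, $$\Gamma_{a,q}^{\mathrm{geom}}(z)=a^{z-1}(q-1)^{z-1}q^{(z-1)(z-2)}\,\Gamma_{q^{-1}}(z),$$ where $\Gamma_{q^{-1}}$ is Jackson's Gamma function with parameter $q^{-1}$.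
   Context: Bhargava factorial over $\mathbb Z$: let $S\subseteq\mathbb Z$ be infinite and $p$ a prime. A $p$-ordering of $S$ is a sequence $(a_n)_{n\ge 0}$ in $S$ chosen greedily so that, for every $n$, $a_n$ minimizes $v_p\bigl(\prod_{j=0}^{n-1}(x-a_j)\bigr)$ over $x\in S$ (given $a_0,\dots,a_{n-1}$). The minimal value $\nu_{S,p}(n)=v_p\bigl(\prod_{j=0}^{n-1}(a_n-a_j)\bigr)$ does not depend on the chosen $p$-ordering (Bhargava). The $n$th Bhargava factorial of $S$ is the positive integer $n!_S=\prod_p p^{\nu_{S,p}(n)}$, and $0!_S=1$. For $0<r<1$, Jackson's Gamma function is $\Gamma_r(z)=(1-r)^{1-z}\dfrac{(r;r)_\infty}{(r^z;r)_\infty}$, where $(u;r)_\infty=\prod_{m\ge 0}(1-ur^m)$. Complex powers of positive real numbers are defined with the real logarithm: $x^z=e^{z\log x}$ for $x>0$. *)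

theory Defs
  imports "HOL-Complex_Analysis.Complex_Analysis"
begin

text \<open>\<^const>\<open>multiplicity\<close> returns 0 at 0, whereas a \<open>p\<close>-ordering needs the valuation of 0 to be
  infinite; hence the extended natural numbers.\<close>

definition padic_val :: "nat \<Rightarrow> int \<Rightarrow> enat" where
  "padic_val p x = (if x = 0 then \<infinity> else enat (multiplicity (int p) x))"

definition p_ordering :: "nat \<Rightarrow> int set \<Rightarrow> (nat \<Rightarrow> int) \<Rightarrow> bool" where
  "p_ordering p S s \<longleftrightarrow>
     (\<forall>n. s n \<in> S \<and>
          (\<forall>x\<in>S. padic_val p (\<Prod>j<n. s n - s j) \<le> padic_val p (\<Prod>j<n. x - s j)))"

text \<open>By Bhargava's theorem the value below is the same for every \<open>p\<close>-ordering.  For infinite \<open>S\<close>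
  it is finite, so \<^const>\<open>the_enat\<close> loses nothing.\<close>

definition bhargava_nu :: "int set \<Rightarrow> nat \<Rightarrow> nat \<Rightarrow> nat" where
  "bhargava_nu S p n =
     (let s = (SOME s. p_ordering p S s) in the_enat (padic_val p (\<Prod>j<n. s n - s j)))"

text \<open>The product over all primes, restricted to the factors different from 1; for infinite \<open>S\<close>
  there are only finitely many of these.\<close>

definition bhargava_factorial :: "int set \<Rightarrow> nat \<Rightarrow> nat" where
  "bhargava_factorial S n = (\<Prod>p | prime p \<and> bhargava_nu S p n \<noteq> 0. p ^ bhargava_nu S p n)"

definition geom_set :: "int \<Rightarrow> int \<Rightarrow> int set" where
  "geom_set a q = {a * q ^ m | m :: nat. True}"

text \<open>Operators are functions on all complex sequences, of which only the restriction to
  \<open>ell2\<close> matters.  The inner product is linear in its first argument.\<close>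

definition ell2 :: "(nat \<Rightarrow> complex) set" where
  "ell2 = {x. summable (\<lambda>n. (cmod (x n))\<^sup>2)}"

definition ell2_norm :: "(nat \<Rightarrow> complex) \<Rightarrow> real" where
  "ell2_norm x = sqrt (\<Sum>n. (cmod (x n))\<^sup>2)"

definition ell2_inner :: "(nat \<Rightarrow> complex) \<Rightarrow> (nat \<Rightarrow> complex) \<Rightarrow> complex" where
  "ell2_inner x y = (\<Sum>n. x n * cnj (y n))"

definition std_basis :: "nat \<Rightarrow> nat \<Rightarrow> complex" where
  "std_basis m = (\<lambda>n. if n = m then 1 else 0)"

definition bounded_op :: "((nat \<Rightarrow> complex) \<Rightarrow> nat \<Rightarrow> complex) \<Rightarrow> bool" where
  "bounded_op T \<longleftrightarrow>
     (\<forall>x\<in>ell2. T x \<in> ell2) \<and>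
     (\<forall>x\<in>ell2. \<forall>y\<in>ell2. T (\<lambda>n. x n + y n) = (\<lambda>n. T x n + T y n)) \<and>
     (\<forall>c. \<forall>x\<in>ell2. T (\<lambda>n. c * x n) = (\<lambda>n. c * T x n)) \<and>
     (\<exists>K. \<forall>x\<in>ell2. ell2_norm (T x) \<le> K * ell2_norm x)"

definition positive_op :: "((nat \<Rightarrow> complex) \<Rightarrow> nat \<Rightarrow> complex) \<Rightarrow> bool" where
  "positive_op P \<longleftrightarrow> bounded_op P \<and> (\<forall>x\<in>ell2. ell2_inner (P x) x \<in> \<real>\<^sub>\<ge>\<^sub>0)"

text \<open>\<open>P\<close> is the absolute value of \<open>T\<close>, the positive square root of the product of the adjoint of
  \<open>T\<close> with \<open>T\<close>.  As a positive operator \<open>P\<close> is self-adjoint, so the second condition says that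
  \<open>P\<close> squared equals that product.\<close>

definition is_abs_op ::
  "((nat \<Rightarrow> complex) \<Rightarrow> nat \<Rightarrow> complex) \<Rightarrow> ((nat \<Rightarrow> complex) \<Rightarrow> nat \<Rightarrow> complex) \<Rightarrow> bool" where
  "is_abs_op T P \<longleftrightarrow>
     positive_op P \<and> (\<forall>x\<in>ell2. \<forall>y\<in>ell2. ell2_inner (P x) (P y) = ell2_inner (T x) (T y))"

definition trace_class :: "((nat \<Rightarrow> complex) \<Rightarrow> nat \<Rightarrow> complex) \<Rightarrow> bool" where
  "trace_class T \<longleftrightarrow>
     bounded_op T \<and>
     (\<exists>P. is_abs_op T P \<and> summable (\<lambda>m. ell2_inner (P (std_basis m)) (std_basis m)))"

definition op_entry :: "((nat \<Rightarrow> complex) \<Rightarrow> nat \<Rightarrow> complex) \<Rightarrow> nat \<Rightarrow> nat \<Rightarrow> complex" where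
  "op_entry A i j = ell2_inner (A (std_basis j)) (std_basis i)"

text \<open>The trace of the \<open>k\<close>-th exterior power of \<open>A\<close>, computed in the orthonormal basis of wedge
  products of standard basis vectors: the sum of all principal \<open>k \<times> k\<close> minors.\<close>

definition trace_ext_power :: "nat \<Rightarrow> ((nat \<Rightarrow> complex) \<Rightarrow> nat \<Rightarrow> complex) \<Rightarrow> complex" where
  "trace_ext_power k A =
     (\<Sum>\<^sub>\<infinity>I\<in>{I. finite I \<and> card I = k}.
        \<Sum>p | p permutes I. of_int (sign p) * (\<Prod>i\<in>I. op_entry A i (p i)))"

text \<open>\<open>fredholm_det T\<close> is the determinant of \<open>T\<close> itself, for \<open>T\<close> of the form identity plus a
  trace class operator \<open>A\<close>: Fredholm's series, i.e. the sum over \<open>k\<close> of the traces of the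
  exterior powers of \<open>A = T - I\<close>.\<close>

definition fredholm_det :: "((nat \<Rightarrow> complex) \<Rightarrow> nat \<Rightarrow> complex) \<Rightarrow> complex" where
  "fredholm_det T = (\<Sum>k. trace_ext_power k (\<lambda>x n. T x n - x n))"

definition Q_op :: "real \<Rightarrow> (nat \<Rightarrow> complex) \<Rightarrow> nat \<Rightarrow> complex" where
  "Q_op r x = (\<lambda>m. of_real (r ^ m) * x m)"

lemma Q_op_std_basis: "Q_op r (std_basis m) = (\<lambda>n. of_real (r ^ m) * std_basis m n)"
  by (auto simp: Q_op_def std_basis_def)

text \<open>Complex powers are \<open>powr\<close>, which for a positive real base uses the real logarithm.  At the
  zeros of the denominators the value is 0, which is the library's convention for the value of a
  meromorphic function at a pole (\<^const>\<open>nicely_meromorphic_on\<close>).\<close>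

definition q_poch_inf :: "complex \<Rightarrow> real \<Rightarrow> complex" where
  "q_poch_inf u r = (\<Prod>m. 1 - u * of_real r ^ m)"

definition jackson_Gamma :: "real \<Rightarrow> complex \<Rightarrow> complex" where
  "jackson_Gamma r z =
     of_real (1 - r) powr (1 - z) *
       (q_poch_inf (of_real r) r / q_poch_inf (of_real r powr z) r)"

definition Gamma_geom :: "int \<Rightarrow> int \<Rightarrow> complex \<Rightarrow> complex" where
  "Gamma_geom a q z =
     (let r = 1 / real_of_int q in
       of_int a powr (z - 1) * of_int q powr ((z - 1)\<^sup>2) *
       (fredholm_det (\<lambda>x n. x n - of_real r * Q_op r x n) /
        fredholm_det (\<lambda>x n. x n - of_real r powr z * Q_op r x n)))"

end

theory Submission
  imports Defs
begin

text \<open>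
  The sequence \<open>a q\<^sup>j\<close> is a \<open>p\<close>-ordering of the geometric set for all primes \<open>p\<close> at once, because
  Gaussian binomial coefficients are integers; as the valuations do not depend on the \<open>p\<close>-ordering,
  the Bhargava factorial is the product of the \<open>a q\<^sup>n - a q\<^sup>j\<close> over \<open>j < n\<close>.  The principal
  minors of a diagonal operator are products of its entries, so Fredholm's series is the expansion
  of an infinite product over finite index sets, and the determinants are \<open>q\<close>-Pochhammer symbols.
  Their quotient at \<open>z = n + 1\<close> telescopes to a finite product.
\<close>

section \<open>Bhargava factorials\<close>

text \<open>Induction on \<open>n\<close>: the new factor \<open>x - t n\<close> splits as
  \<open>(x - s k) + (s k - t n)\<close> against the \<open>k\<close>-th Newton product. No division
  occurs, so the coefficients stay in the ring.\<close>

lemma newton_expansion: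
  fixes s t :: "nat \<Rightarrow> 'a::comm_ring_1"
  shows "\<exists>c. c n = 1 \<and> (\<forall>x. (\<Prod>j<n. x - t j) = (\<Sum>k\<le>n. c k * (\<Prod>j<k. x - s j)))"
proof (induction n)
  case 0
  show ?case by (intro exI[of _ "\<lambda>_. 1"]) simp
next
  case (Suc n)
  then obtain c where c: "c n = 1" "\<And>x. (\<Prod>j<n. x - t j) = (\<Sum>k\<le>n. c k * (\<Prod>j<k. x - s j))"
    by blast
  \<comment> \<open>The first summand comes from raising the degree of Newton product
    \<open>k - 1\<close>, the second from the correction \<open>s k - t n\<close>; the guards cover
    the two end indices.\<close>
  define d where "d k = (if k = 0 then 0 else c (k - 1)) +
    (if k \<le> n then c k * (s k - t n) else 0)" for k
  have "(\<Prod>j<Suc n. x - t j) = (\<Sum>k\<le>Suc n. d k * (\<Prod>j<k. x - s j))" for x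
  proof -
    have "(\<Prod>j<Suc n. x - t j) = (\<Sum>k\<le>n. c k * (\<Prod>j<k. x - s j)) * (x - t n)"
      by (simp add: c)
    also have "\<dots> = (\<Sum>k\<le>n. c k * (\<Prod>j<Suc k. x - s j) + c k * (s k - t n) * (\<Prod>j<k. x - s j))"
      unfolding sum_distrib_right by (intro sum.cong) (auto simp: algebra_simps)
    also have "\<dots> = (\<Sum>k\<le>n. c k * (\<Prod>j<Suc k. x - s j)) +
                     (\<Sum>k\<le>n. c k * (s k - t n) * (\<Prod>j<k. x - s j))"
      by (rule sum.distrib)
    also have "(\<Sum>k\<le>n. c k * (\<Prod>j<Suc k. x - s j)) =
               (\<Sum>k\<le>Suc n. (if k = 0 then 0 else c (k - 1)) * (\<Prod>j<k. x - s j))"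
      by (subst sum.atMost_Suc_shift) simp
    also have "(\<Sum>k\<le>n. c k * (s k - t n) * (\<Prod>j<k. x - s j)) =
               (\<Sum>k\<le>Suc n. (if k \<le> n then c k * (s k - t n) else 0) * (\<Prod>j<k. x - s j))"
      by simp
    finally show ?thesis
      by (simp only: d_def distrib_right sum.distrib)
  qed
  moreover have "d (Suc n) = 1" by (simp add: d_def c)
  ultimately show ?case by blast
qed

text \<open>At \<open>x = 0\<close> both sides hold, so valuation bounds become divisibility
  statements without exceptions.\<close>

lemma enat_le_padic_val_iff:
  assumes "prime p"
  shows "enat e \<le> padic_val p x \<longleftrightarrow> int p ^ e dvd x"
proof (cases "x = 0")
  case False
  have "\<not> is_unit (int p)" using prime_gt_1_nat[OF assms] by simp
  then show ?thesis using False by (simp add: padic_val_def power_dvd_iff_le_multiplicity)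
qed (simp add: padic_val_def)

lemma padic_val_mult:
  assumes "prime p"
  shows "padic_val p (x * y) = padic_val p x + padic_val p y"
  using assms
  by (auto simp: padic_val_def prime_elem_multiplicity_mult_distrib prime_imp_prime_elem)

text \<open>The system is triangular: at \<open>s k\<close> the Newton products beyond index
  \<open>k\<close> vanish, and the earlier terms are divisible by the induction hypothesis together
  with the greedy choice of \<open>s\<close>.\<close>

lemma enat_le_padic_val_combination:
  assumes p: "prime p" and ord: "p_ordering p S s"
    and c: "\<And>x. g x = (\<Sum>k\<le>n. c k * (\<Prod>j<k. x - s j))"
    and g: "\<And>x. x \<in> S \<Longrightarrow> int p ^ e dvd g x"
  shows "k \<le> n \<Longrightarrow> int p ^ e dvd c k * (\<Prod>j<k. s k - s j)"
proof (induction k rule: less_induct)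
  case (less k)
  have "(\<Prod>j<i. s k - s j) = 0" if "k < i" for i
    using that by (intro prod_zero) auto
  then have "g (s k) = (\<Sum>i\<le>k. c i * (\<Prod>j<i. s k - s j))"
    unfolding c using less.prems by (intro sum.mono_neutral_right) auto
  then have "g (s k) = c k * (\<Prod>j<k. s k - s j) + (\<Sum>i<k. c i * (\<Prod>j<i. s k - s j))"
    by (simp add: add.commute flip: lessThan_Suc_atMost)
  moreover have "int p ^ e dvd (\<Sum>i<k. c i * (\<Prod>j<i. s k - s j))"
  proof (rule dvd_sum)
    fix i assume "i \<in> {..<k}"
    then have "enat e \<le> padic_val p (c i * (\<Prod>j<i. s i - s j))"
      using less by (simp add: enat_le_padic_val_iff[OF p])
    \<comment> \<open>\<open>s i\<close> minimizes the valuation of the \<open>i\<close>-th Newton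
      product, and \<open>s k\<close> is one of its competitors in \<open>S\<close>.\<close>
    also have "\<dots> \<le> padic_val p (c i * (\<Prod>j<i. s k - s j))"
      using ord unfolding p_ordering_def padic_val_mult[OF p] by (intro add_left_mono) blast
    finally show "int p ^ e dvd c i * (\<Prod>j<i. s k - s j)"
      by (simp add: enat_le_padic_val_iff[OF p])
  qed
  moreover have "int p ^ e dvd g (s k)" using ord g by (auto simp: p_ordering_def)
  ultimately show ?case by (metis dvd_add_left_iff)
qed

text \<open>Expand the monic polynomial with roots \<open>t\<^sub>j\<close>, \<open>j < n\<close>, in the Newton basis of \<open>s\<close>: a power of
  \<open>p\<close> that divides all its values on \<open>S\<close> also divides the leading Newton term at \<open>s\<^sub>n\<close>.\<close>

lemma p_ordering_padic_val_le:
  assumes p: "prime p" and s: "p_ordering p S s" and t: "p_ordering p S t"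
  shows "padic_val p (\<Prod>j<n. t n - t j) \<le> padic_val p (\<Prod>j<n. s n - s j)"
proof (rule ccontr)
  assume "\<not> ?thesis"
  \<comment> \<open>The smaller valuation is finite; its successor serves as
    \<open>e\<close>.\<close>
  then obtain e where e: "enat e \<le> padic_val p (\<Prod>j<n. t n - t j)"
      "\<not> enat e \<le> padic_val p (\<Prod>j<n. s n - s j)"
    by (cases "padic_val p (\<Prod>j<n. s n - s j)"; cases "padic_val p (\<Prod>j<n. t n - t j)")
       (auto simp: not_le intro: that[of "Suc _"])
  obtain c where c: "c n = 1" "\<And>x. (\<Prod>j<n. x - t j) = (\<Sum>k\<le>n. c k * (\<Prod>j<k. x - s j))"
    using newton_expansion[of n t s] by blast
  have "int p ^ e dvd (\<Prod>j<n. x - t j)" if "x \<in> S" for x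
    using that t e(1) order_trans unfolding p_ordering_def enat_le_padic_val_iff[OF p, symmetric]
    by blast
  from enat_le_padic_val_combination[OF p s c(2) this, of n] show False
    using e(2) c(1) by (simp add: enat_le_padic_val_iff[OF p])
qed

text \<open>The given \<open>s\<close> shows that the choice by \<open>SOME\<close> succeeds, and
  the inequality for two orderings, used in both directions, makes the choice irrelevant. A nonzero
  product keeps \<open>the_enat\<close> away from infinity.\<close>

lemma bhargava_nu_eq:
  assumes "prime p" "p_ordering p S s" "(\<Prod>j<n. s n - s j) \<noteq> 0"
  shows "bhargava_nu S p n = multiplicity (int p) (\<Prod>j<n. s n - s j)"
proof -
  define t where "t = (SOME s. p_ordering p S s)"
  have "p_ordering p S t" unfolding t_def using someI[of "p_ordering p S" s] assms(2) by simp
  then have "padic_val p (\<Prod>j<n. t n - t j) = padic_val p (\<Prod>j<n. s n - s j)"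
    using p_ordering_padic_val_le assms(1,2) by (intro antisym)
  then show ?thesis using assms(3) by (simp add: bhargava_nu_def Let_def padic_val_def flip: t_def)
qed

text \<open>If one sequence is a \<open>p\<close>-ordering for every prime, all the exponents are
  valuations of the same integer, and the defining product is its prime factorization.\<close>

lemma bhargava_factorial_eq:
  assumes "\<And>p. prime p \<Longrightarrow> p_ordering p S s" and N: "(\<Prod>j<n. s n - s j) = int N" and "N > 0"
  shows "bhargava_factorial S n = N"
proof -
  have nu: "bhargava_nu S p n = multiplicity p N" if "prime p" for p
    using bhargava_nu_eq[OF that assms(1)[OF that], of n] N \<open>N > 0\<close>
    by (simp add: multiplicity_def flip: of_nat_power)
  have "{p. prime p \<and> bhargava_nu S p n \<noteq> 0} = prime_factors N"
    using \<open>N > 0\<close> by (auto simp: nu prime_factors_multiplicity)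
  then show ?thesis
    unfolding bhargava_factorial_def using prime_factorization_nat[OF \<open>N > 0\<close>]
    by (simp add: nu in_prime_factors_imp_prime cong: prod.cong)
qed

text \<open>The quotient is the Gaussian binomial coefficient; the induction is its Pascal recurrence.\<close>

lemma prod_geom_dvd:
  fixes q :: "'a::comm_ring_1"
  shows "(\<Prod>j<n. q ^ n - q ^ j) dvd (\<Prod>j<n. q ^ m - q ^ j)"
proof (induction m arbitrary: n)
  case 0
  \<comment> \<open>For positive \<open>n\<close> the right-hand product contains the factor
    \<open>1 - 1\<close> at \<open>j = 0\<close>.\<close>
  show ?case by (cases n) (auto simp: prod.lessThan_Suc_shift simp del: prod.lessThan_Suc)
next
  case (Suc m)
  \<comment> \<open>The factor at \<open>j = 0\<close> is split off, and each of the other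
    \<open>n\<close> factors releases one \<open>q\<close>.\<close>
  have shift: "(\<Prod>j<Suc n. q ^ Suc l - q ^ j) = (q ^ Suc l - 1) * q ^ n * (\<Prod>j<n. q ^ l - q ^ j)"
    for l n
  proof -
    have "(\<Prod>j<Suc n. q ^ Suc l - q ^ j) = (q ^ Suc l - 1) * (\<Prod>j<n. q * (q ^ l - q ^ j))"
      by (subst prod.lessThan_Suc_shift) (simp add: algebra_simps)
    then show ?thesis by (simp add: prod.distrib)
  qed
  show ?case
  proof (cases n)
    case [simp]: (Suc k)
    \<comment> \<open>This is
      \<open>q ^ Suc m - 1 = (q ^ Suc m - q ^ Suc k) + (q ^ Suc k - 1)\<close>, multiplied by the
      remaining factors.\<close>
    have "(\<Prod>j<n. q ^ Suc m - q ^ j) =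
        q ^ n * (\<Prod>j<n. q ^ m - q ^ j) + (q ^ Suc k - 1) * q ^ k * (\<Prod>j<k. q ^ m - q ^ j)"
      unfolding Suc shift by (simp add: algebra_simps)
    moreover have "(\<Prod>j<n. q ^ n - q ^ j) dvd (q ^ Suc k - 1) * q ^ k * (\<Prod>j<k. q ^ m - q ^ j)"
      unfolding Suc shift by (intro mult_dvd_mono dvd_refl Suc.IH)
    ultimately show ?thesis
      using Suc.IH[of n] by (simp only: dvd_add dvd_mult)
  qed simp
qed

text \<open>After the common factor \<open>a ^ n\<close> is removed, \<open>prod_geom_dvd\<close>
  makes the product at \<open>a * q ^ n\<close> a divisor of the product at any competitor.\<close>

lemma p_ordering_geom_set:
  assumes "prime p"
  shows "p_ordering p (geom_set a q) (\<lambda>j. a * q ^ j)"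
  unfolding p_ordering_def
proof (intro allI conjI ballI)
  fix n x assume "x \<in> geom_set a q"
  then obtain m where x: "x = a * q ^ m" by (auto simp: geom_set_def)
  have eq: "(\<Prod>j<n. a * q ^ l - a * q ^ j) = a ^ n * (\<Prod>j<n. q ^ l - q ^ j)" for l
    by (simp add: prod.distrib flip: right_diff_distrib)
  from prod_geom_dvd[of q n m] obtain b where b: "(\<Prod>j<n. q ^ m - q ^ j) = (\<Prod>j<n. q ^ n - q ^ j) * b"
    by (elim dvdE)
  have "(\<Prod>j<n. x - a * q ^ j) = (\<Prod>j<n. a * q ^ n - a * q ^ j) * b"
    unfolding x eq b by (simp add: mult.assoc)
  then show "padic_val p (\<Prod>j<n. a * q ^ n - a * q ^ j) \<le> padic_val p (\<Prod>j<n. x - a * q ^ j)"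
    by (simp add: padic_val_mult[OF assms])
qed (auto simp: geom_set_def)

lemma bhargava_factorial_geom_set:
  assumes "a \<ge> 1" "q \<ge> 2"
  shows "int (bhargava_factorial (geom_set a q) n) = (\<Prod>j<n. a * q ^ n - a * q ^ j)"
proof -
  have pos: "(\<Prod>j<n. a * q ^ n - a * q ^ j) > 0"
    using assms by (intro prod_pos) (auto simp: power_strict_increasing)
  then have "bhargava_factorial (geom_set a q) n = nat (\<Prod>j<n. a * q ^ n - a * q ^ j)"
    by (intro bhargava_factorial_eq[where s = "\<lambda>j. a * q ^ j"] p_ordering_geom_set) auto
  then show ?thesis using pos by simp
qed

section \<open>Fredholm determinants of diagonal operators\<close>

text \<open>Partial products expand over the subsets of \<open>{..<N}\<close>. The same expansion
  for the norms, bounded by an exponential, gives absolute summability; the value is then the limit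
  of the partial products.\<close>

lemma has_sum_prod_finite_subsets:
  fixes w :: "nat \<Rightarrow> complex"
  assumes "summable (\<lambda>n. norm (w n))"
  shows "((\<lambda>I. \<Prod>i\<in>I. w i) has_sum (\<Prod>n. 1 + w n)) {I. finite I}"
proof -
  \<comment> \<open>Polymorphic because it is applied both to \<open>w\<close> and to its real
    norms.\<close>
  have expand: "(\<Sum>I\<in>Pow {..<N}. \<Prod>i\<in>I. v i) = (\<Prod>i<N. 1 + v i)"
    for N and v :: "nat \<Rightarrow> 'a::comm_semiring_1"
    using prod_add[of "{..<N}" v "\<lambda>_. 1"] by (simp add: add.commute)
  have bound: "\<exists>N. F \<subseteq> Pow {..<N}" if F: "F \<subseteq> {I. finite I}" "finite F" for F :: "nat set set"
  proof -
    have "finite (\<Union>F)" using F by auto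
    then obtain N where "\<Union>F \<subseteq> {..<N}" by (metis finite_nat_iff_bounded)
    then show ?thesis by blast
  qed
  have "(\<lambda>I. norm (\<Prod>i\<in>I. w i)) summable_on {I. finite I}"
  proof (rule nonneg_bdd_above_summable_on)
    show "bdd_above (sum (\<lambda>I. norm (\<Prod>i\<in>I. w i)) ` {F. F \<subseteq> {I. finite I} \<and> finite F})"
    proof (rule bdd_aboveI2)
      fix F :: "nat set set" assume "F \<in> {F. F \<subseteq> {I. finite I} \<and> finite F}"
      then obtain N where N: "F \<subseteq> Pow {..<N}" using bound[of F] by blast
      have "(\<Sum>I\<in>F. norm (\<Prod>i\<in>I. w i)) \<le> (\<Sum>I\<in>Pow {..<N}. norm (\<Prod>i\<in>I. w i))"
        using N by (intro sum_mono2) auto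
      also have "\<dots> = (\<Prod>i<N. 1 + norm (w i))"
        using expand[of "\<lambda>i. norm (w i)" N] by (simp add: prod_norm)
      also have "\<dots> \<le> exp (\<Sum>i<N. norm (w i))"
        by (intro prod_le_exp_sum) auto
      also have "\<dots> \<le> exp (\<Sum>i. norm (w i))"
        using sum_le_suminf[OF assms, of "{..<N}"] by simp
      finally show "(\<Sum>I\<in>F. norm (\<Prod>i\<in>I. w i)) \<le> exp (\<Sum>i. norm (w i))" .
    qed
  qed simp
  then have "(\<lambda>I. \<Prod>i\<in>I. w i) summable_on {I. finite I}"
    by (rule abs_summable_summable)
  then obtain L where L: "((\<lambda>I. \<Prod>i\<in>I. w i) has_sum L) {I. finite I}"
    by (auto simp: summable_on_def)
  \<comment> \<open>The families \<open>Pow {..<N}\<close> are cofinal among finite families of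
    finite sets, so the unordered sum may be computed along them.\<close>
  have lim: "filterlim (\<lambda>N. Pow {..<N}) (finite_subsets_at_top {I. finite (I :: nat set)}) sequentially"
    unfolding filterlim_iff eventually_finite_subsets_at_top
  proof clarify
    fix P :: "nat set set \<Rightarrow> bool" and F :: "nat set set"
    assume F: "finite F" "F \<subseteq> {I. finite I}"
      and P: "\<forall>Y. finite Y \<and> F \<subseteq> Y \<and> Y \<subseteq> {I. finite I} \<longrightarrow> P Y"
    from bound[OF F(2,1)] obtain N where N: "F \<subseteq> Pow {..<N}" ..
    show "\<forall>\<^sub>F M in sequentially. P (Pow {..<M})"
    proof (rule eventually_sequentiallyI)
      fix M assume "N \<le> M"
      then have "F \<subseteq> Pow {..<M}" using N by fastforce
      moreover have "Pow {..<M} \<subseteq> {I. finite I}" by (auto intro: finite_subset)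
      ultimately show "P (Pow {..<M})" by (intro P[rule_format]) simp
    qed
  qed
  have "(\<lambda>N. \<Sum>I\<in>Pow {..<N}. \<Prod>i\<in>I. w i) \<longlonglongrightarrow> L"
    by (rule filterlim_compose[OF L[unfolded has_sum_def] lim])
  then have "(\<lambda>N. \<Prod>i<N. 1 + w i) \<longlonglongrightarrow> L"
    by (simp add: expand)
  moreover have "convergent_prod (\<lambda>n. 1 + w n)"
    using assms by (intro abs_convergent_prod_imp_convergent_prod summable_imp_abs_convergent_prod) simp
  then have "(\<lambda>N. \<Prod>i<N. 1 + w i) \<longlonglongrightarrow> (\<Prod>n. 1 + w n)"
    using convergent_prod_LIMSEQ LIMSEQ_lessThan_iff_atMost[of "\<lambda>A. \<Prod>i\<in>A. 1 + w i"] by simp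
  ultimately show ?thesis using L LIMSEQ_unique by blast
qed

lemma op_entry_diagonal:
  assumes "\<And>x n. A x n = w n * x n"
  shows "op_entry A i j = (if i = j then w i else 0)"
proof -
  have "(\<lambda>n. A (std_basis j) n * cnj (std_basis i n)) = (\<lambda>n. if n = i then if i = j then w i else 0 else 0)"
    by (auto simp: assms std_basis_def)
  moreover have "\<dots> sums (if i = j then w i else 0)"
    using sums_single[of i "\<lambda>_. if i = j then w i else 0"] .
  ultimately show ?thesis by (simp add: op_entry_def ell2_inner_def sums_iff)
qed

text \<open>A permutation other than \<open>id\<close> moves some index of \<open>I\<close> and so
  picks up a vanishing off-diagonal entry.\<close>

lemma trace_ext_power_diagonal:
  assumes "\<And>x n. A x n = w n * x n"
  shows "trace_ext_power k A = (\<Sum>\<^sub>\<infinity>I\<in>{I. finite I \<and> card I = k}. \<Prod>i\<in>I. w i)"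
  unfolding trace_ext_power_def
proof (rule infsum_cong)
  fix I :: "nat set" assume "I \<in> {I. finite I \<and> card I = k}"
  then have I: "finite I" by simp
  have "(\<Prod>i\<in>I. op_entry A i (p i)) = 0" if p: "p permutes I" "p \<noteq> id" for p
  proof -
    obtain i where "p i \<noteq> i" using p(2) by (auto simp: fun_eq_iff)
    then have "i \<in> I" using p(1) by (auto simp: permutes_def)
    then show ?thesis using I \<open>p i \<noteq> i\<close>
      by (intro prod_zero) (auto simp: op_entry_diagonal[of A w, OF assms] intro!: bexI[of _ i])
  qed
  then have "(\<Sum>p | p permutes I. of_int (sign p) * (\<Prod>i\<in>I. op_entry A i (p i))) =
      (\<Sum>p\<in>{id}. of_int (sign p) * (\<Prod>i\<in>I. op_entry A i (p i)))"
    using I by (intro sum.mono_neutral_right) (auto simp: finite_permutations permutes_id)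
  then show "(\<Sum>p | p permutes I. of_int (sign p) * (\<Prod>i\<in>I. op_entry A i (p i))) = (\<Prod>i\<in>I. w i)"
    by (simp add: op_entry_diagonal[of A w, OF assms] sign_id)
qed

text \<open>Grouping the finite index sets by cardinality, via \<open>I\<close> to
  \<open>(card I, I)\<close>, turns the expansion of the infinite product into Fredholm's
  series.\<close>

lemma fredholm_det_diagonal:
  assumes T: "\<And>x n. T x n = (1 + w n) * x n" and w: "summable (\<lambda>n. norm (w n))"
  shows "fredholm_det T = (\<Prod>n. 1 + w n)"
proof -
  let ?B = "\<lambda>k::nat. {I :: nat set. finite I \<and> card I = k}"
  have hs: "((\<lambda>I. \<Prod>i\<in>I. w i) has_sum (\<Prod>n. 1 + w n)) {I. finite I}"
    using w by (rule has_sum_prod_finite_subsets)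
  have "((\<lambda>(k, I). \<Prod>i\<in>I. w i) has_sum (\<Prod>n. 1 + w n)) (SIGMA k:UNIV. ?B k)"
    using hs
    by (rule has_sum_reindex_bij_witness[where i = "\<lambda>I. (card I, I)" and j = snd, THEN iffD2, rotated -1]) auto
  moreover have "((\<lambda>I. (\<lambda>(k, I). \<Prod>i\<in>I. w i) (k, I)) has_sum trace_ext_power k (\<lambda>x n. T x n - x n)) (?B k)" for k
  proof -
    have "(\<lambda>I. \<Prod>i\<in>I. w i) summable_on ?B k"
      using has_sum_imp_summable[OF hs] by (rule summable_on_subset_banach) auto
    moreover have "trace_ext_power k (\<lambda>x n. T x n - x n) = (\<Sum>\<^sub>\<infinity>I\<in>?B k. \<Prod>i\<in>I. w i)"
      by (rule trace_ext_power_diagonal) (simp add: T algebra_simps)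
    ultimately show ?thesis by simp
  qed
  ultimately have "((\<lambda>k. trace_ext_power k (\<lambda>x n. T x n - x n)) has_sum (\<Prod>n. 1 + w n)) UNIV"
    by (rule has_sum_SigmaD)
  then have "(\<lambda>k. trace_ext_power k (\<lambda>x n. T x n - x n)) sums (\<Prod>n. 1 + w n)"
    by (rule has_sum_imp_sums)
  then show ?thesis by (simp only: fredholm_det_def sums_iff)
qed

section \<open>The operator and the Gamma function\<close>

context
  fixes r :: real
  assumes r: "0 < r" "r < 1"
begin

lemma Q_op_bounded:
  assumes "x \<in> ell2"
  shows "Q_op r x \<in> ell2" and "ell2_norm (Q_op r x) \<le> ell2_norm x"
proof -
  have le: "(cmod (Q_op r x n))\<^sup>2 \<le> (cmod (x n))\<^sup>2" for n
    using r by (simp add: Q_op_def norm_mult norm_power mult_left_le_one_le power_le_one power_mult_distrib)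
  have x: "summable (\<lambda>n. (cmod (x n))\<^sup>2)" using assms by (simp add: ell2_def)
  then have Qx: "summable (\<lambda>n. (cmod (Q_op r x n))\<^sup>2)"
    by (rule summable_comparison_test') (use le in simp)
  then show "Q_op r x \<in> ell2" by (simp add: ell2_def)
  show "ell2_norm (Q_op r x) \<le> ell2_norm x"
    unfolding ell2_norm_def using le Qx x by (intro real_sqrt_le_mono suminf_le)
qed

lemma bounded_op_Q_op: "bounded_op (Q_op r)"
  unfolding bounded_op_def
proof (intro conjI exI[of _ 1])
  show "\<forall>x\<in>ell2. Q_op r x \<in> ell2" "\<forall>x\<in>ell2. ell2_norm (Q_op r x) \<le> 1 * ell2_norm x"
    using Q_op_bounded by simp_all
qed (auto simp: Q_op_def algebra_simps)

lemma positive_op_Q_op: "positive_op (Q_op r)"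
  unfolding positive_op_def
proof (intro conjI bounded_op_Q_op ballI)
  fix x assume "x \<in> ell2"
  then have x: "summable (\<lambda>n. (cmod (x n))\<^sup>2)" by (simp add: ell2_def)
  have "summable (\<lambda>n. r ^ n * (cmod (x n))\<^sup>2)"
    using x by (rule summable_comparison_test')
      (use r in \<open>simp add: abs_mult mult_left_le_one_le power_le_one\<close>)
  moreover have "(\<lambda>n. Q_op r x n * cnj (x n)) = (\<lambda>n. complex_of_real (r ^ n * (cmod (x n))\<^sup>2))"
    by (simp add: fun_eq_iff Q_op_def mult.assoc complex_norm_square[symmetric])
  ultimately have "ell2_inner (Q_op r x) x = complex_of_real (\<Sum>n. r ^ n * (cmod (x n))\<^sup>2)"
    and "(\<Sum>n. r ^ n * (cmod (x n))\<^sup>2) \<ge> 0"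
    unfolding ell2_inner_def using r by (auto simp only: suminf_of_real intro!: suminf_nonneg) auto
  then show "ell2_inner (Q_op r x) x \<in> \<real>\<^sub>\<ge>\<^sub>0"
    by simp
qed

text \<open>Being positive, the operator is its own absolute value, and its trace is a geometric
  series.\<close>

lemma trace_class_Q_op: "trace_class (Q_op r)"
  unfolding trace_class_def is_abs_op_def
proof (intro conjI exI[of _ "Q_op r"])
  have "ell2_inner (Q_op r (std_basis m)) (std_basis m) = of_real r ^ m" for m
    using op_entry_diagonal[of "Q_op r" "\<lambda>m. of_real (r ^ m)" m m]
    by (simp add: op_entry_def Q_op_def)
  then show "summable (\<lambda>m. ell2_inner (Q_op r (std_basis m)) (std_basis m))"
    using r by simp
qed (auto simp: bounded_op_Q_op positive_op_Q_op)

section \<open>The infinite \<open>q\<close>-Pochhammer symbol\<close>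

lemma summable_q_poch: "summable (\<lambda>n. norm (- (u * of_real r ^ n) :: complex))"
proof -
  have "summable (\<lambda>n. norm u * r ^ n)" using r by (intro summable_mult) simp
  then show ?thesis using r by (simp add: norm_mult norm_power)
qed

lemma convergent_prod_q_poch: "convergent_prod (\<lambda>n. 1 - u * of_real r ^ n :: complex)"
  using summable_q_poch[of u]
  by (intro abs_convergent_prod_imp_convergent_prod summable_imp_abs_convergent_prod) simp

text \<open>Arbitrary \<open>u\<close> covers both determinants: \<open>u = r\<close> in the
  numerator and \<open>u = r powr z\<close> in the denominator.\<close>

lemma fredholm_det_Q_op: "fredholm_det (\<lambda>x n. x n - u * Q_op r x n) = q_poch_inf u r"
proof -
  have "fredholm_det (\<lambda>x n. x n - u * Q_op r x n) = (\<Prod>n. 1 + - (u * of_real r ^ n))"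
    by (rule fredholm_det_diagonal[OF _ summable_q_poch]) (simp add: Q_op_def left_diff_distrib)
  then show ?thesis by (simp add: q_poch_inf_def)
qed

text \<open>The partial products are polynomials in \<open>u\<close> that converge uniformly on unit
  discs, by the M-test with majorant \<open>(norm z + 1) * r ^ n\<close>.\<close>

lemma holomorphic_q_poch_inf: "(\<lambda>u. q_poch_inf u r) holomorphic_on UNIV"
proof (rule holomorphic_uniform_sequence[where f = "\<lambda>N u. \<Prod>n<N. 1 - u * of_real r ^ n"])
  fix z :: complex
  let ?A = "cball z 1"
  have "uniformly_convergent_on ?A (\<lambda>N u. \<Sum>n<N. norm (1 - u * of_real r ^ n - 1))"
  proof (rule Weierstrass_m_test')
    show "norm (norm (1 - u * of_real r ^ n - 1)) \<le> (norm z + 1) * r ^ n" if "u \<in> ?A" for n u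
    proof -
      have "norm u \<le> norm z + 1"
        using that norm_triangle_ineq2[of u z] by (simp add: dist_norm norm_minus_commute)
      then show ?thesis using r by (simp add: norm_mult norm_power mult_right_mono)
    qed
    show "summable (\<lambda>n. (norm z + 1) * r ^ n)" using r by (intro summable_mult) simp
  qed
  then have "uniformly_convergent_on ?A (\<lambda>N u. \<Prod>n<N. 1 - u * of_real r ^ n)"
    by (intro uniformly_convergent_on_prod' continuous_intros) auto
  then obtain g where g: "uniform_limit ?A (\<lambda>N u. \<Prod>n<N. 1 - u * of_real r ^ n) g sequentially"
    by (auto simp: uniformly_convergent_on_def)
  have "g u = q_poch_inf u r" if "u \<in> ?A" for u
  proof (rule LIMSEQ_unique)
    show "(\<lambda>N. \<Prod>n<N. 1 - u * of_real r ^ n) \<longlonglongrightarrow> g u"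
      using g that by (rule tendsto_uniform_limitI)
    show "(\<lambda>N. \<Prod>n<N. 1 - u * of_real r ^ n) \<longlonglongrightarrow> q_poch_inf u r"
      unfolding q_poch_inf_def
      using convergent_prod_LIMSEQ[OF convergent_prod_q_poch]
        LIMSEQ_lessThan_iff_atMost[of "\<lambda>A. \<Prod>n\<in>A. 1 - u * of_real r ^ n"] by simp
  qed
  then have "uniform_limit ?A (\<lambda>N u. \<Prod>n<N. 1 - u * of_real r ^ n) (\<lambda>u. q_poch_inf u r) sequentially"
    using g by (subst uniform_limit_cong'[where i = g and g = "\<lambda>N u. \<Prod>n<N. 1 - u * of_real r ^ n"]) auto
  then show "\<exists>d>0. cball z d \<subseteq> UNIV \<and>
      uniform_limit (cball z d) (\<lambda>N u. \<Prod>n<N. 1 - u * of_real r ^ n) (\<lambda>u. q_poch_inf u r) sequentially"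
    by (intro exI[of _ 1]) auto
qed (auto intro!: holomorphic_intros)

lemma one_minus_power_Suc_ne_0: "1 - of_real r * of_real r ^ n \<noteq> (0::complex)"
proof -
  have "r * r ^ n < 1" using r power_Suc_less_one[of r n] by simp
  then have "complex_of_real (r * r ^ n) \<noteq> 1" by (metis of_real_eq_1_iff less_irrefl)
  then show ?thesis by simp
qed

lemma q_poch_inf_ne_0: "q_poch_inf (of_real r) r \<noteq> 0"
  unfolding q_poch_inf_def
  by (rule prodinf_nonzero[OF convergent_prod_q_poch one_minus_power_Suc_ne_0])

text \<open>The denominator is the numerator without its first \<open>n\<close> factors.\<close>

lemma q_poch_inf_quotient:
  "q_poch_inf (of_real r) r / q_poch_inf (of_real r ^ Suc n) r = (\<Prod>i<n. 1 - of_real r ^ Suc i)"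
proof -
  have "(\<lambda>i. 1 - complex_of_real r * of_real r ^ (i + n)) = (\<lambda>i. 1 - of_real r ^ Suc n * of_real r ^ i)"
    by (simp add: power_add mult_ac)
  then have "q_poch_inf (of_real r) r = q_poch_inf (of_real r ^ Suc n) r * (\<Prod>i<n. 1 - of_real r ^ Suc i)"
    using prodinf_split_initial_segment[OF convergent_prod_q_poch[of "of_real r"] one_minus_power_Suc_ne_0, of n]
    unfolding q_poch_inf_def by (simp only: power_Suc)
  \<comment> \<open>The denominator is nonzero because it divides the nonzero numerator.\<close>
  then show ?thesis using q_poch_inf_ne_0 by (metis mult_zero_left nonzero_mult_div_cancel_left)
qed

end

section \<open>The geometric Gamma function\<close>

lemma Gamma_geom_eq:
  assumes "q \<ge> 2"
  shows "Gamma_geom a q z = of_int a powr (z - 1) * of_int q powr ((z - 1)\<^sup>2) *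
    (q_poch_inf (of_real (1 / real_of_int q)) (1 / real_of_int q) /
     q_poch_inf (of_real (1 / real_of_int q) powr z) (1 / real_of_int q))"
  using assms unfolding Gamma_geom_def Let_def by (subst (1 2) fredholm_det_Q_op) auto

lemma Gamma_geom_nicely_meromorphic:
  assumes "a \<ge> 1" "q \<ge> 2"
  shows "Gamma_geom a q nicely_meromorphic_on UNIV"
proof -
  \<comment> \<open>The reciprocal of the function is entire.\<close>
  define r where "r = 1 / real_of_int q"
  have r: "0 < r" "r < 1" using assms by (auto simp: r_def)
  define H where "H z = q_poch_inf (of_real r powr z) r /
    (of_int a powr (z - 1) * of_int q powr ((z - 1)\<^sup>2) * q_poch_inf (of_real r) r)" for z
  have "(\<lambda>z. of_real r powr z :: complex) holomorphic_on UNIV"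
    using r by (intro holomorphic_intros) auto
  from holomorphic_on_compose_gen[OF this holomorphic_q_poch_inf[OF r]]
  have "(\<lambda>z. q_poch_inf (of_real r powr z) r) holomorphic_on UNIV"
    by (simp add: o_def)
  then have "H holomorphic_on UNIV"
    unfolding H_def using assms q_poch_inf_ne_0[OF r] by (intro holomorphic_intros) auto
  then have "(\<lambda>z. inverse (H z)) nicely_meromorphic_on UNIV"
    by (intro nicely_meromorphic_on_inverse analytic_on_imp_nicely_meromorphic_on)
       (simp add: analytic_on_open)
  \<comment> \<open>Equality holds at the poles too: \<open>inverse 0 = 0\<close> agrees with the
    value of a quotient with denominator 0.\<close>
  moreover have "(\<lambda>z. inverse (H z)) = Gamma_geom a q"
    using assms by (simp add: fun_eq_iff Gamma_geom_eq H_def r_def)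
  ultimately show ?thesis by simp
qed

text \<open>The prefactor supplies \<open>a * q ^ n\<close> to each of the \<open>n\<close> factors
  \<open>1 - r ^ (n - j)\<close>, which gives \<open>a * q ^ n - a * q ^ j\<close>.\<close>

lemma Gamma_geom_of_nat:
  assumes "a \<ge> 1" "q \<ge> 2"
  shows "Gamma_geom a q (of_nat n + 1) = of_nat (bhargava_factorial (geom_set a q) n)"
proof -
  define r where "r = 1 / real_of_int q"
  have r: "0 < r" "r < 1" using assms by (auto simp: r_def)
  have q: "of_int q \<noteq> (0::complex)" using assms by simp
  have rq: "complex_of_real r = inverse (of_int q)" by (simp add: r_def field_simps)
  have pw: "c powr of_nat m = c ^ m" if "c \<noteq> 0" for c :: complex and m
    using that by (simp add: powr_nat')
  have sq: "(of_nat n + 1 - 1 :: complex)\<^sup>2 = of_nat (n * n)" by (simp add: power2_eq_square)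
  have "Gamma_geom a q (of_nat n + 1) =
      of_int a ^ n * of_int q ^ (n * n) * (\<Prod>i<n. 1 - of_real r ^ Suc i)"
  proof -
    have "of_real r powr (of_nat n + 1) = complex_of_real r ^ Suc n"
      using pw[of "of_real r" "Suc n"] r by (simp add: add.commute)
    then show ?thesis
      using assms q_poch_inf_quotient[OF r, of n] pw[of "of_int a" n] pw[of "of_int q" "n * n"] sq
      by (simp add: Gamma_geom_eq flip: r_def)
  qed
  \<comment> \<open>Reversing the order of the factors, \<open>i = n - Suc j\<close>, turns the
    exponent \<open>Suc i\<close> into \<open>n - j\<close>.\<close>
  also have "(\<Prod>i<n. 1 - complex_of_real r ^ Suc i) = (\<Prod>j<n. 1 - of_real r ^ (n - j))"
    by (subst prod.nat_diff_reindex[symmetric]) (auto intro!: prod.cong simp: Suc_diff_Suc)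
  also have "of_int a ^ n * of_int q ^ (n * n) * \<dots> =
      (\<Prod>j<n. of_int a * of_int q ^ n * (1 - complex_of_real r ^ (n - j)))"
    by (simp add: prod.distrib power_mult power_mult_distrib)
  also have "\<dots> = (\<Prod>j<n. of_int (a * q ^ n - a * q ^ j))"
  proof (rule prod.cong)
    fix j assume "j \<in> {..<n}"
    then have "of_int q ^ n = (of_int q ^ j * of_int q ^ (n - j) :: complex)"
      by (simp flip: power_add)
    then show "of_int a * of_int q ^ n * (1 - complex_of_real r ^ (n - j)) = of_int (a * q ^ n - a * q ^ j)"
      using q by (simp add: rq power_inverse field_simps)
  qed simp
  also have "\<dots> = of_int (int (bhargava_factorial (geom_set a q) n))"
    by (subst bhargava_factorial_geom_set[OF assms]) simp
  finally show ?thesis by simp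
qed

text \<open>The Pochhammer quotients on both sides coincide, so only the power prefactors are
  compared. Their bases are positive, so the logarithms are real and satisfy the usual quotient
  rule.\<close>

lemma Gamma_geom_jackson_Gamma:
  assumes "a \<ge> 1" "q \<ge> 2"
  shows "Gamma_geom a q z = of_int a powr (z - 1) * of_int (q - 1) powr (z - 1) *
            of_int q powr ((z - 1) * (z - 2)) * jackson_Gamma (1 / real_of_int q) z"
proof -
  define x y where "x = ln (real_of_int (q - 1))" and "y = ln (real_of_int q)"
  have ln: "Ln (of_int (q - 1)) = of_real x" "Ln (of_int q) = of_real y"
    "Ln (of_real (1 - 1 / real_of_int q)) = of_real (x - y)"
  proof -
    have "ln (1 - 1 / real_of_int q) = ln (real_of_int (q - 1) / real_of_int q)"
      using assms by (simp add: field_simps)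
    then have l: "ln (1 - 1 / real_of_int q) = x - y"
      using assms by (simp add: x_def y_def ln_div)
    show "Ln (of_int (q - 1)) = of_real x"
      using assms Ln_of_real[of "real_of_int (q - 1)"] by (simp add: x_def)
    show "Ln (of_int q) = of_real y"
      using assms Ln_of_real[of "real_of_int q"] by (simp add: y_def)
    show "Ln (of_real (1 - 1 / real_of_int q)) = of_real (x - y)"
      using assms by (subst Ln_of_real) (auto simp: l)
  qed
  have "of_int (q - 1) powr (z - 1) * of_int q powr ((z - 1) * (z - 2)) *
      of_real (1 - 1 / real_of_int q) powr (1 - z) = of_int q powr ((z - 1)\<^sup>2)"
  proof -
    have nz: "of_int (q - 1) \<noteq> (0::complex)" "of_int q \<noteq> (0::complex)"
      "complex_of_real (1 - 1 / real_of_int q) \<noteq> 0"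
      using assms by (simp_all only: of_int_eq_0_iff of_real_eq_0_iff) auto
    have "of_int (q - 1) powr (z - 1) * of_int q powr ((z - 1) * (z - 2)) *
        of_real (1 - 1 / real_of_int q) powr (1 - z) =
        exp ((z - 1) * of_real x + (z - 1) * (z - 2) * of_real y + (1 - z) * of_real (x - y))"
      unfolding powr_def ln using nz by (simp only: if_False exp_add)
    \<comment> \<open>The coefficient of \<open>x\<close> cancels, and that of \<open>y\<close> is
      \<open>(z - 1) * (z - 2) + (z - 1)\<close>.\<close>
    also have "(z - 1) * of_real x + (z - 1) * (z - 2) * of_real y + (1 - z) * of_real (x - y) =
        (z - 1)\<^sup>2 * complex_of_real y"
      by (simp add: algebra_simps power2_eq_square)
    also have "exp \<dots> = of_int q powr ((z - 1)\<^sup>2)"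
      unfolding powr_def ln using nz by (simp only: if_False)
    finally show ?thesis .
  qed
  then show ?thesis
    unfolding Gamma_geom_eq[OF assms(2)] jackson_Gamma_def by (metis (no_types, lifting) mult.assoc)
qed

theorem proposition6p1:
  fixes a q :: int
  assumes "a \<ge> 1" and "q \<ge> 2"
  shows "trace_class (Q_op (1 / real_of_int q)) \<and>
         Gamma_geom a q nicely_meromorphic_on UNIV \<and>
         Gamma_geom a q 1 = 1 \<and>
         (\<forall>n::nat. Gamma_geom a q (of_nat n + 1) =
                     of_nat (bhargava_factorial (geom_set a q) n)) \<and>
         (\<forall>z::complex. Gamma_geom a q z =
            of_int a powr (z - 1) * of_int (q - 1) powr (z - 1) *
            of_int q powr ((z - 1) * (z - 2)) * jackson_Gamma (1 / real_of_int q) z)"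
proof (intro conjI allI)
  show "trace_class (Q_op (1 / real_of_int q))" using assms by (intro trace_class_Q_op) auto
  have "int (bhargava_factorial (geom_set a q) 0) = 1"
    using bhargava_factorial_geom_set[OF assms, of 0] by simp
  then show "Gamma_geom a q 1 = 1" using Gamma_geom_of_nat[OF assms, of 0] by simp
qed (intro Gamma_geom_nicely_meromorphic Gamma_geom_of_nat Gamma_geom_jackson_Gamma assms)+

end
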